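(* If $\mathrel{\perp\!\!\!\perp}$ is federated and admits an algebraic point, then $\mathrm{AIRAIndL}(\mathrel{\perp\!\!\!\perp})$ is complete: for every set $\Sigma$ of independence atoms, if $\Sigma \models \vec{x} \perp \vec{y}$ then $\Sigma \vdash \vec{x} \perp \vec{y}$.
   Context: Let $(\mathbf{K}, \preccurlyeq)$ be an AEC with amalgamation, joint embedding and arbitrarily large models, with monster model $\mathfrak{M}$, and $\mathrel{\perp\!\!\!\perp}$ a pre-independence relation on bounded subsets of $\mathfrak{M}$ (Invariance, Existence, Monotonicity, Base Monotonicity, Symmetry, Transitivity, Normality, Finite Character, Anti-Reflexivity). Semantics: $\mathfrak{M} \models_s \vec{x} \perp \vec{y}$ iff $s(\vec{x}) \mathrel{\perp\!\!\!\perp}_{\emptyset} s(\vec{y})$; $\Sigma \models \phi$ iff every assignment satisfying $\Sigma$ satisfies $\phi$. Deductive system: ($a_3$) $\vec{x} \perp \emptyset$; ($b_3$) $\vec{x} \perp \vec{y} \Rightarrow \vec{y} \perp \vec{x}$; ($c_3$) $\vec{x} \perp \vec{y}\vec{z} \Rightarrow \vec{x} \perp \vec{y}$; ($d_3$) $\vec{x} \perp \vec{y}$ and $\vec{x}\vec{y} \perp \vec{z} \Rightarrow \vec{x} \perp \vec{y}\vec{z}$; ($e_3$) $x \perp x \Rightarrow x \perp \vec{y}$; ($f_3$) $\vec{x} \perp \vec{y} \Rightarrow \pi\vec{x} \perp \sigma\vec{y}$ for permutations; ($g_3$) $\vec{x} y \vec{z} \perp \vec{w} \Rightarrow \vec{x}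 y y \vec{z} \perp \vec{w}$. An injective sequence $(a_i)$ is independent over $\emptyset$ if $(a_i \mid i<j) \mathrel{\perp\!\!\!\perp}_\emptyset a_j$ for all $j$; for $n \ge 1$, an independent $(a_i \mid i<n)$ is federated if some $d$ is not $\mathrel{\perp\!\!\!\perp}_\emptyset$-independent from $a_0\cdots a_{n-1}$ but $d \mathrel{\perp\!\!\!\perp}_\emptyset (a_i \mid i<n) - a_j$ for all $j<n$. $\mathrel{\perp\!\!\!\perp}$ is federated if for every $n \geq 1$ there is a federated sequence of length $n$ (over $\emptyset$). An algebraic point is $e \in \mathfrak{M}$ with $e \mathrel{\perp\!\!\!\perp}_\emptyset e$. *)

theory Defs
  imports Main "HOL-Library.Multiset"
begin

unbundle cardinal_syntax

section \<open>First-order structures\<close>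

text \<open>
  The symbols of a signature are given by sets, so that a signature may have no function
  symbols or no relation symbols.
\<close>

record ('f, 'r) signature =
  funs :: "'f set"
  rels :: "'r set"
  farity :: "'f \<Rightarrow> nat"
  rarity :: "'r \<Rightarrow> nat"

record ('f, 'r, 'u) fostruct =
  univ :: "'u set"
  fn :: "'f \<Rightarrow> 'u list \<Rightarrow> 'u"
  rel :: "'r \<Rightarrow> 'u list \<Rightarrow> bool"

definition fargs :: "('f, 'r) signature \<Rightarrow> ('f, 'r, 'u) fostruct \<Rightarrow> 'f \<Rightarrow> 'u list set" where
  "fargs L A f = {xs. f \<in> funs L \<and> length xs = farity L f \<and> set xs \<subseteq> univ A}"

definition rargs :: "('f, 'r) signature \<Rightarrow> ('f, 'r, 'u) fostruct \<Rightarrow> 'r \<Rightarrow> 'u list set" where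
  "rargs L A R = {xs. R \<in> rels L \<and> length xs = rarity L R \<and> set xs \<subseteq> univ A}"

text \<open>
  Interpretations take a fixed value at meaningless arguments, so that equality of structures
  in HOL is equality of structures.
\<close>

definition is_struct :: "('f, 'r) signature \<Rightarrow> ('f, 'r, 'u) fostruct \<Rightarrow> bool" where
  "is_struct L A \<longleftrightarrow>
     univ A \<noteq> {} \<and>
     (\<forall>f. \<forall>xs\<in>fargs L A f. fn A f xs \<in> univ A) \<and>
     (\<forall>f xs. xs \<notin> fargs L A f \<longrightarrow> fn A f xs = undefined) \<and>
     (\<forall>R xs. xs \<notin> rargs L A R \<longrightarrow> \<not> rel A R xs)"

definition substruct ::
  "('f, 'r) signature \<Rightarrow> ('f, 'r, 'u) fostruct \<Rightarrow> ('f, 'r, 'u) fostruct \<Rightarrow> bool" where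
  "substruct L A B \<longleftrightarrow>
     univ A \<subseteq> univ B \<and>
     (\<forall>f. \<forall>xs\<in>fargs L A f. fn A f xs = fn B f xs) \<and>
     (\<forall>R. \<forall>xs\<in>rargs L A R. rel A R xs \<longleftrightarrow> rel B R xs)"

definition struct_iso ::
  "('f, 'r) signature \<Rightarrow> ('u \<Rightarrow> 'u) \<Rightarrow> ('f, 'r, 'u) fostruct \<Rightarrow> ('f, 'r, 'u) fostruct \<Rightarrow> bool" where
  "struct_iso L h A B \<longleftrightarrow>
     bij_betw h (univ A) (univ B) \<and>
     (\<forall>f. \<forall>xs\<in>fargs L A f. h (fn A f xs) = fn B f (map h xs)) \<and>
     (\<forall>R. \<forall>xs\<in>rargs L A R. rel A R xs \<longleftrightarrow> rel B R (map h xs))"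

text \<open>
  For a nonempty family \<open>F\<close> that is directed under \<^const>\<open>substruct\<close>, the following determines
  \<open>U\<close> uniquely, and such a \<open>U\<close> exists.
\<close>

definition is_union ::
  "('f, 'r) signature \<Rightarrow> ('f, 'r, 'u) fostruct set \<Rightarrow> ('f, 'r, 'u) fostruct \<Rightarrow> bool" where
  "is_union L F U \<longleftrightarrow> is_struct L U \<and> univ U = (\<Union>A\<in>F. univ A) \<and> (\<forall>A\<in>F. substruct L A U)"


section \<open>Abstract elementary classes\<close>

text \<open>
  The class consists of structures with universe inside an arbitrary type \<open>'u\<close>, which plays the
  role of the universe of sets; cardinals are cardinal orders on \<open>'u\<close>. A chain
  \<open>(A\<^sub>i | i < \<delta>)\<close> is indexed by a well-order on a subset of \<open>'u\<close>: a strictly increasing chain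
  of subsets of \<open>'u\<close> has no longer index, and repetitions do not affect the union.
\<close>

definition limit_index :: "'i rel \<Rightarrow> 'i \<Rightarrow> bool" where
  "limit_index r i \<longleftrightarrow>
     i \<in> Field r \<and> underS r i \<noteq> {} \<and> (\<forall>j\<in>underS r i. \<exists>k\<in>underS r i. j \<in> underS r k)"

definition cont_chain ::
  "('f, 'r) signature \<Rightarrow> (('f, 'r, 'u) fostruct \<Rightarrow> ('f, 'r, 'u) fostruct \<Rightarrow> bool) \<Rightarrow>
   'u rel \<Rightarrow> ('u \<Rightarrow> ('f, 'r, 'u) fostruct) \<Rightarrow> bool" where
  "cont_chain L le r A \<longleftrightarrow>
     Well_order r \<and> Field r \<noteq> {} \<and>
     (\<forall>(i, j)\<in>r. le (A i) (A j)) \<and>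
     (\<forall>i. limit_index r i \<longrightarrow> is_union L (A ` underS r i) (A i))"

locale aec =
  fixes L :: "('f, 'r) signature"
    and K :: "('f, 'r, 'u) fostruct set"
    and le :: "('f, 'r, 'u) fostruct \<Rightarrow> ('f, 'r, 'u) fostruct \<Rightarrow> bool"
    and LS :: "'u rel"
  assumes K_struct: "A \<in> K \<Longrightarrow> is_struct L A"
    and le_K: "le A B \<Longrightarrow> A \<in> K \<and> B \<in> K"
    and K_iso: "\<lbrakk>A \<in> K; is_struct L B; struct_iso L h A B\<rbrakk> \<Longrightarrow> B \<in> K"
    and le_iso: "\<lbrakk>le A B; is_struct L A'; is_struct L B'; struct_iso L h A A'; struct_iso L h B B'\<rbrakk>
                 \<Longrightarrow> le A' B'"
    and le_substruct: "le A B \<Longrightarrow> substruct L A B"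
    and le_refl: "A \<in> K \<Longrightarrow> le A A"
    and le_antisym: "\<lbrakk>le A B; le B A\<rbrakk> \<Longrightarrow> A = B"
    and le_trans: "\<lbrakk>le A B; le B C\<rbrakk> \<Longrightarrow> le A C"
    and union_K: "\<lbrakk>cont_chain L le r F; is_union L (F ` Field r) U\<rbrakk> \<Longrightarrow> U \<in> K"
    and union_upper: "\<lbrakk>cont_chain L le r F; is_union L (F ` Field r) U; i \<in> Field r\<rbrakk>
                      \<Longrightarrow> le (F i) U"
    and union_least: "\<lbrakk>cont_chain L le r F; is_union L (F ` Field r) U; N \<in> K;
                       \<And>i. i \<in> Field r \<Longrightarrow> le (F i) N\<rbrakk> \<Longrightarrow> le U N"
    and coherence: "\<lbrakk>le A C; le B C; substruct L A B\<rbrakk> \<Longrightarrow> le A B"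
    and LS_card: "Card_order LS" "cinfinite LS" "LS <o |UNIV :: 'u set|"
    and LS_submodel: "\<lbrakk>A \<in> K; X \<subseteq> univ A\<rbrakk>
                      \<Longrightarrow> \<exists>C. X \<subseteq> univ C \<and> le C A \<and> |univ C| \<le>o |X| +c LS"

definition K_embedding ::
  "('f, 'r) signature \<Rightarrow> (('f, 'r, 'u) fostruct \<Rightarrow> ('f, 'r, 'u) fostruct \<Rightarrow> bool) \<Rightarrow>
   ('u \<Rightarrow> 'u) \<Rightarrow> ('f, 'r, 'u) fostruct \<Rightarrow> ('f, 'r, 'u) fostruct \<Rightarrow> bool" where
  "K_embedding L le h A B \<longleftrightarrow> (\<exists>C. le C B \<and> struct_iso L h A C)"

definition amalgamation ::
  "('f, 'r) signature \<Rightarrow> ('f, 'r, 'u) fostruct set \<Rightarrow>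
   (('f, 'r, 'u) fostruct \<Rightarrow> ('f, 'r, 'u) fostruct \<Rightarrow> bool) \<Rightarrow> bool" where
  "amalgamation L K le \<longleftrightarrow>
     (\<forall>A B C. le A B \<and> le A C \<longrightarrow>
        (\<exists>D\<in>K. \<exists>f g. K_embedding L le f B D \<and> K_embedding L le g C D \<and> (\<forall>a\<in>univ A. f a = g a)))"

definition joint_embedding ::
  "('f, 'r) signature \<Rightarrow> ('f, 'r, 'u) fostruct set \<Rightarrow>
   (('f, 'r, 'u) fostruct \<Rightarrow> ('f, 'r, 'u) fostruct \<Rightarrow> bool) \<Rightarrow> bool" where
  "joint_embedding L K le \<longleftrightarrow>
     (\<forall>A\<in>K. \<forall>B\<in>K. \<exists>C\<in>K. \<exists>f g. K_embedding L le f A C \<and> K_embedding L le g B C)"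

definition arbitrarily_large_models :: "('f, 'r, 'u) fostruct set \<Rightarrow> bool" where
  "arbitrarily_large_models K \<longleftrightarrow> (\<forall>X :: 'u set. \<exists>A\<in>K. |X| \<le>o |univ A| )"

definition monster_model ::
  "('f, 'r) signature \<Rightarrow> ('f, 'r, 'u) fostruct set \<Rightarrow>
   (('f, 'r, 'u) fostruct \<Rightarrow> ('f, 'r, 'u) fostruct \<Rightarrow> bool) \<Rightarrow> 'u rel \<Rightarrow>
   'u rel \<Rightarrow> ('f, 'r, 'u) fostruct \<Rightarrow> bool" where
  "monster_model L K le LS \<kappa> M \<longleftrightarrow>
     M \<in> K \<and> Card_order \<kappa> \<and> LS <o \<kappa> \<and> \<kappa> \<le>o |univ M| \<and>
     (\<forall>A\<in>K. |univ A| <o \<kappa> \<longrightarrow> (\<exists>h. K_embedding L le h A M)) \<and>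
     (\<forall>A B h. le A M \<and> le B M \<and> |univ A| <o \<kappa> \<and> struct_iso L h A B \<longrightarrow>
        (\<exists>g. struct_iso L g M M \<and> (\<forall>a\<in>univ A. g a = h a)))"


section \<open>Pre-independence relations\<close>

definition bdd_sub :: "('f, 'r, 'u) fostruct \<Rightarrow> 'u rel \<Rightarrow> 'u set \<Rightarrow> bool" where
  "bdd_sub M \<kappa> X \<longleftrightarrow> X \<subseteq> univ M \<and> |X| <o \<kappa>"

text \<open>\<open>ind A C B\<close> stands for: \<open>A\<close> is independent from \<open>B\<close> over \<open>C\<close>.\<close>

locale pre_independence =
  fixes L :: "('f, 'r) signature"
    and M :: "('f, 'r, 'u) fostruct"
    and \<kappa> :: "'u rel"
    and ind :: "'u set \<Rightarrow> 'u set \<Rightarrow> 'u set \<Rightarrow> bool"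
  assumes invariance:
      "\<lbrakk>bdd_sub M \<kappa> A; bdd_sub M \<kappa> B; bdd_sub M \<kappa> C; struct_iso L f M M; ind A C B\<rbrakk>
       \<Longrightarrow> ind (f ` A) (f ` C) (f ` B)"
    and existence:
      "\<lbrakk>bdd_sub M \<kappa> A; bdd_sub M \<kappa> B\<rbrakk> \<Longrightarrow> ind A A B"
    and monotonicity:
      "\<lbrakk>bdd_sub M \<kappa> A; bdd_sub M \<kappa> B; bdd_sub M \<kappa> C; A' \<subseteq> A; B' \<subseteq> B; ind A C B\<rbrakk>
       \<Longrightarrow> ind A' C B'"
    and base_monotonicity:
      "\<lbrakk>bdd_sub M \<kappa> A; bdd_sub M \<kappa> B; D \<subseteq> C; C \<subseteq> B; ind A D B\<rbrakk> \<Longrightarrow> ind A C B"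
    and symmetry:
      "\<lbrakk>bdd_sub M \<kappa> A; bdd_sub M \<kappa> B; bdd_sub M \<kappa> C; ind A C B\<rbrakk> \<Longrightarrow> ind B C A"
    and transitivity:
      "\<lbrakk>bdd_sub M \<kappa> A; bdd_sub M \<kappa> B; D \<subseteq> C; C \<subseteq> B; ind B C A; ind C D A\<rbrakk> \<Longrightarrow> ind B D A"
    and normality:
      "\<lbrakk>bdd_sub M \<kappa> A; bdd_sub M \<kappa> B; bdd_sub M \<kappa> C; ind A C B\<rbrakk> \<Longrightarrow> ind (A \<union> C) C B"
    and finite_character:
      "\<lbrakk>bdd_sub M \<kappa> A; bdd_sub M \<kappa> B; bdd_sub M \<kappa> C; \<And>A0. \<lbrakk>finite A0; A0 \<subseteq> A\<rbrakk> \<Longrightarrow> ind A0 C B\<rbrakk>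
       \<Longrightarrow> ind A C B"
    and anti_reflexivity:
      "\<lbrakk>bdd_sub M \<kappa> A; bdd_sub M \<kappa> B; bdd_sub M \<kappa> C; ind A B A\<rbrakk> \<Longrightarrow> ind A B C"

definition indep_seq ::
  "('f, 'r, 'u) fostruct \<Rightarrow> ('u set \<Rightarrow> 'u set \<Rightarrow> 'u set \<Rightarrow> bool) \<Rightarrow> 'u list \<Rightarrow> bool" where
  "indep_seq M ind as \<longleftrightarrow>
     set as \<subseteq> univ M \<and> distinct as \<and> (\<forall>j<length as. ind (set (take j as)) {} {as ! j})"

definition federated_seq ::
  "('f, 'r, 'u) fostruct \<Rightarrow> ('u set \<Rightarrow> 'u set \<Rightarrow> 'u set \<Rightarrow> bool) \<Rightarrow> 'u list \<Rightarrow> bool" where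
  "federated_seq M ind as \<longleftrightarrow>
     1 \<le> length as \<and> indep_seq M ind as \<and>
     (\<exists>d\<in>univ M. \<not> ind {d} {} (set as) \<and> (\<forall>j<length as. ind {d} {} (set as - {as ! j})))"

definition federated ::
  "('f, 'r, 'u) fostruct \<Rightarrow> ('u set \<Rightarrow> 'u set \<Rightarrow> 'u set \<Rightarrow> bool) \<Rightarrow> bool" where
  "federated M ind \<longleftrightarrow> (\<forall>n\<ge>1. \<exists>as. length as = n \<and> federated_seq M ind as)"

definition algebraic_point ::
  "('f, 'r, 'u) fostruct \<Rightarrow> ('u set \<Rightarrow> 'u set \<Rightarrow> 'u set \<Rightarrow> bool) \<Rightarrow> 'u \<Rightarrow> bool" where
  "algebraic_point M ind e \<longleftrightarrow> e \<in> univ M \<and> ind {e} {} {e}"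


section \<open>Atomic independence logic\<close>

datatype 'v ind_atom = Indep "'v list" "'v list"  (infix "\<perp>" 55)

fun sat_atom ::
  "('u set \<Rightarrow> 'u set \<Rightarrow> 'u set \<Rightarrow> bool) \<Rightarrow> ('v \<Rightarrow> 'u) \<Rightarrow> 'v ind_atom \<Rightarrow> bool" where
  "sat_atom ind s (xs \<perp> ys) \<longleftrightarrow> ind (s ` set xs) {} (s ` set ys)"

definition entails ::
  "('f, 'r, 'u) fostruct \<Rightarrow> ('u set \<Rightarrow> 'u set \<Rightarrow> 'u set \<Rightarrow> bool) \<Rightarrow>
   'v ind_atom set \<Rightarrow> 'v ind_atom \<Rightarrow> bool" where
  "entails M ind \<Sigma> \<phi> \<longleftrightarrow>
     (\<forall>s. range s \<subseteq> univ M \<and> (\<forall>\<psi>\<in>\<Sigma>. sat_atom ind s \<psi>) \<longrightarrow> sat_atom ind s \<phi>)"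

inductive deduces :: "'v ind_atom set \<Rightarrow> 'v ind_atom \<Rightarrow> bool"  (infix "\<turnstile>" 50)
  for \<Sigma> :: "'v ind_atom set" where
  hyp: "\<phi> \<in> \<Sigma> \<Longrightarrow> \<Sigma> \<turnstile> \<phi>"
| a3: "\<Sigma> \<turnstile> xs \<perp> []"
| b3: "\<Sigma> \<turnstile> xs \<perp> ys \<Longrightarrow> \<Sigma> \<turnstile> ys \<perp> xs"
| c3: "\<Sigma> \<turnstile> xs \<perp> (ys @ zs) \<Longrightarrow> \<Sigma> \<turnstile> xs \<perp> ys"
| d3: "\<Sigma> \<turnstile> xs \<perp> ys \<Longrightarrow> \<Sigma> \<turnstile> (xs @ ys) \<perp> zs \<Longrightarrow> \<Sigma> \<turnstile> xs \<perp> (ys @ zs)"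
| e3: "\<Sigma> \<turnstile> [x] \<perp> [x] \<Longrightarrow> \<Sigma> \<turnstile> [x] \<perp> ys"
| f3: "\<Sigma> \<turnstile> xs \<perp> ys \<Longrightarrow> mset xs' = mset xs \<Longrightarrow> mset ys' = mset ys \<Longrightarrow> \<Sigma> \<turnstile> xs' \<perp> ys'"
| g3: "\<Sigma> \<turnstile> (xs @ [y] @ zs) \<perp> ws \<Longrightarrow> \<Sigma> \<turnstile> (xs @ [y, y] @ zs) \<perp> ws"

end

theory Submission
  imports Defs "HOL-Library.Product_Order"
begin

text \<open>
  Derivability from \<open>\<Sigma>\<close>, viewed as a relation between finite sets of variables, and independence
  over \<open>\<emptyset>\<close>, viewed as a relation between finite subsets of the monster model, satisfy the same
  axioms. Completeness amounts to separating each underivable pair of sets by a map that carries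
  derivable pairs to independent ones. It suffices to separate the minimal underivable pairs
  \<open>(A, B)\<close>. No variable of \<open>A \<union> B\<close> is then provably independent from itself, and so either
  \<open>A = B = {x}\<close>, or \<open>A\<close> and \<open>B\<close> are disjoint. Send \<open>x\<close> to a non-algebraic point in the first
  case, and \<open>A \<union> B\<close> to a federated sequence together with its witness in the second; send all other
  variables to an algebraic point. Two disjoint nonempty sets of entries of a federated sequence
  with its witness are dependent just when they exhaust it. A derivable pair partitioning
  \<open>A \<union> B\<close> would, together with the derivable pairs below \<open>(A, B)\<close>, make \<open>(A, B)\<close> derivable, and
  so derivable pairs are sent to independent ones.
\<close>

section \<open>Independence relations between finite sets\<close>

locale finite_independence =
  fixes U :: "'a set"
    and indep :: "'a set \<Rightarrow> 'a set \<Rightarrow> bool"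
  assumes indep_finite: "indep A B \<Longrightarrow> finite A"
    and indep_carrier: "indep A B \<Longrightarrow> A \<subseteq> U"
    and indep_empty_right: "\<lbrakk>finite A; A \<subseteq> U\<rbrakk> \<Longrightarrow> indep A {}"
    and indep_sym: "indep A B \<Longrightarrow> indep B A"
    and indep_mono_right: "\<lbrakk>indep A B; B' \<subseteq> B\<rbrakk> \<Longrightarrow> indep A B'"
    and indep_exchange: "\<lbrakk>indep A B; indep (A \<union> B) C\<rbrakk> \<Longrightarrow> indep A (B \<union> C)"
    and indep_constant: "\<lbrakk>indep {x} {x}; finite B; B \<subseteq> U\<rbrakk> \<Longrightarrow> indep {x} B"
begin

lemma indep_mono: "\<lbrakk>indep A B; A' \<subseteq> A; B' \<subseteq> B\<rbrakk> \<Longrightarrow> indep A' B'"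
  using indep_mono_right indep_sym by meson

lemma indep_empty_left: "\<lbrakk>finite B; B \<subseteq> U\<rbrakk> \<Longrightarrow> indep {} B"
  by (rule indep_sym) (rule indep_empty_right)

lemma indep_insert_left:
  assumes "indep A B" "indep {x} (A \<union> B)"
  shows "indep (insert x A) B"
proof -
  have "indep (B \<union> A) {x}"
    using indep_sym[OF assms(2)] by (simp add: Un_commute)
  then have "indep B (A \<union> {x})"
    by (rule indep_exchange[OF indep_sym[OF assms(1)]])
  then show ?thesis
    using indep_sym[of B "insert x A"] by simp
qed

lemma indep_insert_right:
  assumes "indep A B" "indep {x} (A \<union> B)"
  shows "indep A (insert x B)"
proof -
  have "indep (insert x B) A"
    using indep_sym[OF assms(1)] by (rule indep_insert_left) (simp add: assms(2) Un_commute)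
  then show ?thesis
    by (rule indep_sym)
qed

lemma not_indep_insert_left: "\<lbrakk>indep {x} A; \<not> indep {x} (A \<union> B)\<rbrakk> \<Longrightarrow> \<not> indep (insert x A) B"
  using indep_exchange[of "{x}" A B] by auto

lemma indep_insert_constant:
  assumes "indep {x} {x}" "indep A B"
  shows "indep (insert x A) (insert x B)"
proof -
  have "insert x (A \<union> B) \<subseteq> U" "finite (insert x (A \<union> B))"
    using assms indep_sym[OF assms(2)] by (auto dest: indep_carrier indep_finite)
  then have const: "indep {x} C" if "C \<subseteq> insert x (A \<union> B)" for C
    using that by (intro indep_constant[OF assms(1)]) (auto intro: finite_subset)
  have "indep (insert x A) B"
    using assms(2) by (rule indep_insert_left) (rule const, blast)
  then show ?thesis
    by (rule indep_insert_right) (rule const, blast)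
qed

lemma indep_if_indep_on_parts:
  assumes XY: "indep X Y" and cover: "A \<union> B \<subseteq> X \<union> Y"
    and X: "indep (A \<inter> X) (B \<inter> X)" and Y: "indep (A \<inter> Y) (B \<inter> Y)"
  shows "indep A B"
proof -
  have "indep (B \<inter> X \<union> A \<inter> X) (A \<inter> Y)"
    using XY by (rule indep_mono) auto
  with indep_sym[OF X] have "indep (B \<inter> X) (A \<inter> X \<union> A \<inter> Y)"
    by (rule indep_exchange)
  moreover have "A \<inter> X \<union> A \<inter> Y = A"
    using cover by blast
  ultimately have A_BX: "indep A (B \<inter> X)"
    using indep_sym[of "B \<inter> X" A] by simp
  have "indep (B \<inter> Y \<union> A \<inter> Y) X"
    using indep_sym[OF XY] by (rule indep_mono) auto
  with indep_sym[OF Y] have "indep (B \<inter> Y) (A \<inter> Y \<union> X)"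
    by (rule indep_exchange)
  from indep_sym[OF this] have "indep (A \<union> B \<inter> X) (B \<inter> Y)"
    by (rule indep_mono) (use cover in auto)
  with A_BX have "indep A (B \<inter> X \<union> B \<inter> Y)"
    by (rule indep_exchange)
  moreover have "B \<inter> X \<union> B \<inter> Y = B"
    using cover by blast
  ultimately show ?thesis
    by simp
qed

subsection \<open>Minimal dependent pairs\<close>

definition minimal_dependent :: "'a set \<Rightarrow> 'a set \<Rightarrow> bool" where
  "minimal_dependent A B \<longleftrightarrow>
     finite A \<and> finite B \<and> A \<subseteq> U \<and> B \<subseteq> U \<and> \<not> indep A B \<and>
     (\<forall>A' B'. A' \<subseteq> A \<and> B' \<subseteq> B \<and> (A', B') \<noteq> (A, B) \<longrightarrow> indep A' B')"

lemma minimal_dependent_below: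
  "\<lbrakk>minimal_dependent A B; A' \<subseteq> A; B' \<subseteq> B; A' \<noteq> A \<or> B' \<noteq> B\<rbrakk> \<Longrightarrow> indep A' B'"
  unfolding minimal_dependent_def by auto

lemma minimal_dependent_sym: "minimal_dependent A B \<Longrightarrow> minimal_dependent B A"
  unfolding minimal_dependent_def by (metis indep_sym prod.inject)

lemma minimal_dependent_exists:
  assumes "finite A" "finite B" "A \<subseteq> U" "B \<subseteq> U" "\<not> indep A B"
  obtains A' B' where "A' \<subseteq> A" "B' \<subseteq> B" "minimal_dependent A' B'"
proof -
  let ?dependent = "{(X, Y). X \<subseteq> A \<and> Y \<subseteq> B \<and> \<not> indep X Y}"
  have "finite ?dependent"
    by (rule finite_subset[of _ "Pow A \<times> Pow B"]) (use assms in auto)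
  moreover have "(A, B) \<in> ?dependent"
    using assms(5) by simp
  ultimately obtain m where "m \<in> ?dependent" "\<forall>p\<in>?dependent. p \<le> m \<longrightarrow> m = p"
    using finite_has_minimal2[of ?dependent "(A, B)"] by blast
  moreover obtain A' B' where "m = (A', B')"
    by fastforce
  ultimately have sub: "A' \<subseteq> A" "B' \<subseteq> B" and dep: "\<not> indep A' B'"
    and "\<forall>X Y. X \<subseteq> A \<and> Y \<subseteq> B \<and> \<not> indep X Y \<and> X \<subseteq> A' \<and> Y \<subseteq> B' \<longrightarrow> X = A' \<and> Y = B'"
    by auto
  then have "\<forall>X Y. X \<subseteq> A' \<and> Y \<subseteq> B' \<and> (X, Y) \<noteq> (A', B') \<longrightarrow> indep X Y"
    by (metis order_trans)
  moreover have "finite A'" "finite B'" "A' \<subseteq> U" "B' \<subseteq> U"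
    using sub assms(1-4) finite_subset by blast+
  ultimately show ?thesis
    using that sub dep by (simp add: minimal_dependent_def)
qed

lemma minimal_dependent_nonempty:
  assumes "minimal_dependent A B"
  shows "A \<noteq> {}" "B \<noteq> {}"
  using assms indep_empty_right indep_empty_left unfolding minimal_dependent_def by auto

lemma minimal_dependent_not_constant:
  assumes "minimal_dependent A B" "x \<in> A \<union> B"
  shows "\<not> indep {x} {x}"
proof
  assume const: "indep {x} {x}"
  have False if min: "minimal_dependent A B" and "x \<in> A" for A B
  proof -
    have "indep (A - {x}) B"
      using \<open>x \<in> A\<close> by (intro minimal_dependent_below[OF min]) auto
    with const have "indep (insert x (A - {x})) (insert x B)"
      by (rule indep_insert_constant)
    then have "indep A B"
      by (rule indep_mono) auto
    then show False
      using min by (simp add: minimal_dependent_def)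
  qed
  then show False
    using assms minimal_dependent_sym by blast
qed

lemma minimal_dependent_cases:
  assumes "minimal_dependent A B"
  obtains (diagonal) x where "A = {x}" "B = {x}" | (disjoint) "A \<inter> B = {}"
proof (cases "A \<inter> B = {}")
  case False
  then obtain x where "x \<in> A" "x \<in> B" by blast
  moreover from this have "\<not> indep {x} {x}"
    using minimal_dependent_not_constant[OF assms] by blast
  ultimately have "A = {x}" "B = {x}"
    using minimal_dependent_below[OF assms, of "{x}" "{x}"] by auto
  then show ?thesis
    by (rule diagonal)
qed (rule disjoint)

lemma minimal_dependent_indep_disjoint:
  assumes "minimal_dependent A B" "indep X Y" "X \<subseteq> A \<union> B"
  shows "X \<inter> Y = {}"
proof (rule ccontr)
  assume "X \<inter> Y \<noteq> {}"
  then obtain x where "x \<in> X" "x \<in> Y" by blast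
  moreover from this have "indep {x} {x}"
    using indep_mono[OF assms(2)] by simp
  ultimately show False
    using minimal_dependent_not_constant[OF assms(1)] assms(3) by blast
qed

lemma minimal_dependent_indep_proper:
  assumes min: "minimal_dependent A B" and XY: "indep X Y" "X \<union> Y \<subseteq> A \<union> B"
    and ne: "X \<noteq> {}" "Y \<noteq> {}"
  shows "X \<union> Y \<subset> A \<union> B"
proof (rule ccontr)
  assume "\<not> ?thesis"
  then have un: "X \<union> Y = A \<union> B"
    using XY(2) by blast
  have "X \<inter> Y = {}"
    using minimal_dependent_indep_disjoint[OF min XY(1)] XY(2) by blast
  then have proper: "A \<inter> X \<noteq> A \<or> B \<inter> X \<noteq> B" "A \<inter> Y \<noteq> A \<or> B \<inter> Y \<noteq> B"
    using un ne by blast+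
  have "indep (A \<inter> X) (B \<inter> X)"
    using proper(1) by (rule minimal_dependent_below[OF min Int_lower1 Int_lower1])
  moreover have "indep (A \<inter> Y) (B \<inter> Y)"
    using proper(2) by (rule minimal_dependent_below[OF min Int_lower1 Int_lower1])
  ultimately have "indep A B"
    by (rule indep_if_indep_on_parts[OF XY(1), rotated]) (simp add: un)
  then show False
    using min by (simp add: minimal_dependent_def)
qed

subsection \<open>Independent families and circuits\<close>

definition indep_family :: "'i set \<Rightarrow> ('i \<Rightarrow> 'a) \<Rightarrow> bool" where
  "indep_family I t \<longleftrightarrow> (\<forall>P Q. P \<subseteq> I \<and> Q \<subseteq> I \<and> P \<inter> Q = {} \<longrightarrow> indep (t ` P) (t ` Q))"

lemma indep_familyD:
  "\<lbrakk>indep_family I t; P \<subseteq> I; Q \<subseteq> I; P \<inter> Q = {}\<rbrakk> \<Longrightarrow> indep (t ` P) (t ` Q)"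
  unfolding indep_family_def by blast

lemma indep_family_empty: "indep_family {} t"
  unfolding indep_family_def by (simp add: indep_empty_right)

lemma indep_family_subset: "\<lbrakk>indep_family I t; J \<subseteq> I\<rbrakk> \<Longrightarrow> indep_family J t"
  unfolding indep_family_def by (meson order_trans)

lemma indep_family_insert:
  assumes fam: "indep_family I t" and new: "indep {t x} (t ` I)"
  shows "indep_family (insert x I) t"
  unfolding indep_family_def
proof (intro allI impI, elim conjE)
  fix P Q
  assume PQ: "P \<subseteq> insert x I" "Q \<subseteq> insert x I" "P \<inter> Q = {}"
  define P' Q' where "P' = P - {x}" and "Q' = Q - {x}"
  have sub: "P' \<subseteq> I" "Q' \<subseteq> I" "P' \<inter> Q' = {}"
    using PQ by (auto simp: P'_def Q'_def)
  then have base: "indep (t ` P') (t ` Q')"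
    by (rule indep_familyD[OF fam])
  have x: "indep {t x} (t ` P' \<union> t ` Q')"
    using new by (rule indep_mono_right) (use sub in blast)
  consider "P = P'" "Q = Q'" | "P = insert x P'" "Q = Q'" | "P = P'" "Q = insert x Q'"
    using PQ(3) unfolding P'_def Q'_def by blast
  then show "indep (t ` P) (t ` Q)"
    using indep_insert_left[OF base x] indep_insert_right[OF base x] base by cases simp_all
qed

lemma indep_family_sequence:
  fixes t :: "nat \<Rightarrow> 'a"
  assumes "\<And>i. i < n \<Longrightarrow> indep (t ` {..<i}) {t i}"
  shows "indep_family {..<n} t"
  using assms
proof (induction n)
  case 0
  then show ?case
    by (simp add: indep_family_empty)
next
  case (Suc n)
  have "indep {t n} (t ` {..<n})"
    using Suc.prems by (rule indep_sym) simp
  with Suc have "indep_family (insert n {..<n}) t"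
    by (simp add: indep_family_insert)
  then show ?case
    by (simp add: lessThan_Suc)
qed

lemma indep_family_reindex:
  assumes "indep_family (f ` I) t" "inj_on f I"
  shows "indep_family I (t \<circ> f)"
  unfolding indep_family_def
proof (intro allI impI, elim conjE)
  fix P Q
  assume PQ: "P \<subseteq> I" "Q \<subseteq> I" "P \<inter> Q = {}"
  then have "f ` P \<inter> f ` Q = {}"
    using inj_on_image_Int[OF assms(2) PQ(1,2)] by simp
  then show "indep ((t \<circ> f) ` P) ((t \<circ> f) ` Q)"
    using indep_familyD[OF assms(1), of "f ` P" "f ` Q"] PQ by (simp add: image_comp image_mono)
qed

text \<open>
  Families may repeat values. In contrast to matroids, a one-element family is always a circuit,
  whether or not its value is independent from itself.
\<close>

definition circuit :: "'i set \<Rightarrow> ('i \<Rightarrow> 'a) \<Rightarrow> bool" where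
  "circuit V t \<longleftrightarrow>
     t ` V \<subseteq> U \<and> (\<forall>J. J \<subset> V \<longrightarrow> indep_family J t) \<and>
     (\<forall>P Q. P \<noteq> {} \<and> Q \<noteq> {} \<and> P \<inter> Q = {} \<and> P \<union> Q = V \<longrightarrow> \<not> indep (t ` P) (t ` Q))"

lemma circuit_proper_subset: "\<lbrakk>circuit V t; J \<subset> V\<rbrakk> \<Longrightarrow> indep_family J t"
  by (simp add: circuit_def)

lemma circuit_partition:
  "\<lbrakk>circuit V t; P \<noteq> {}; Q \<noteq> {}; P \<inter> Q = {}; P \<union> Q = V\<rbrakk> \<Longrightarrow> \<not> indep (t ` P) (t ` Q)"
  by (simp add: circuit_def)

lemma circuit_not_constant:
  assumes circ: "circuit V t" "finite V" and x: "x \<in> V" "V \<noteq> {x}"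
  shows "\<not> indep {t x} {t x}"
proof
  assume "indep {t x} {t x}"
  then have "indep {t x} (t ` (V - {x}))"
    by (rule indep_constant) (use circ in \<open>auto simp: circuit_def\<close>)
  moreover have "\<not> indep (t ` {x}) (t ` (V - {x}))"
    by (rule circuit_partition[OF circ(1)]) (use x in auto)
  ultimately show False
    by simp
qed

lemma indep_family_psubset_insert:
  assumes fam: "indep_family I t" and crit: "\<And>i. i \<in> I \<Longrightarrow> indep {t x} (t ` (I - {i}))"
    and J: "J \<subset> insert x I"
  shows "indep_family J t"
proof (cases "x \<in> J")
  case True
  then obtain i where i: "i \<in> I" "i \<notin> J"
    using J by blast
  have "indep_family (insert x (I - {i})) t"
    using indep_family_subset[OF fam Diff_subset] crit[OF i(1)] by (rule indep_family_insert)
  then show ?thesis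
    by (rule indep_family_subset) (use J i in blast)
next
  case False
  show ?thesis
    by (rule indep_family_subset[OF fam]) (use J False in blast)
qed

lemma circuit_insert:
  assumes fam: "indep_family I t" and x: "x \<notin> I" "t x \<in> U" and I: "t ` I \<subseteq> U"
    and dep: "\<not> indep {t x} (t ` I)"
    and crit: "\<And>i. i \<in> I \<Longrightarrow> indep {t x} (t ` (I - {i}))"
  shows "circuit (insert x I) t"
  unfolding circuit_def
proof (intro conjI allI impI)
  show "t ` insert x I \<subseteq> U"
    using x(2) I by simp
next
  fix J
  assume "J \<subset> insert x I"
  with fam crit show "indep_family J t"
    by (rule indep_family_psubset_insert)
next
  have not_indep: "\<not> indep (t ` P) (t ` Q)"
    if PQ: "x \<in> P" "Q \<noteq> {}" "P \<inter> Q = {}" "P \<union> Q = insert x I" for P Q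
  proof -
    define P' where "P' = P - {x}"
    have P: "P = insert x P'" and I: "I = P' \<union> Q"
      using PQ x(1) by (auto simp: P'_def)
    obtain i where i: "i \<in> Q"
      using PQ(2) by blast
    have "indep {t x} (t ` P')"
      using crit[of i] by (rule indep_mono_right) (use I i PQ(3) P in auto)
    moreover have "\<not> indep {t x} (t ` P' \<union> t ` Q)"
      using dep by (simp add: I image_Un)
    ultimately show ?thesis
      using not_indep_insert_left by (simp add: P)
  qed
  fix P Q
  assume PQ: "P \<noteq> {} \<and> Q \<noteq> {} \<and> P \<inter> Q = {} \<and> P \<union> Q = insert x I"
  then have "\<not> indep (t ` P) (t ` Q) \<or> \<not> indep (t ` Q) (t ` P)"
    using not_indep[of P Q] not_indep[of Q P] by blast
  then show "\<not> indep (t ` P) (t ` Q)"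
    using indep_sym[of "t ` P" "t ` Q"] by blast
qed

lemma circuit_reindex:
  assumes circ: "circuit (f ` V) t" and inj: "inj_on f V"
  shows "circuit V (t \<circ> f)"
  unfolding circuit_def
proof (intro conjI allI impI)
  show "(t \<circ> f) ` V \<subseteq> U"
    using circ by (auto simp: circuit_def)
next
  fix J
  assume J: "J \<subset> V"
  then have "f ` J \<subset> f ` V"
    using inj by (rule image_strict_mono[rotated])
  then have "indep_family (f ` J) t"
    by (rule circuit_proper_subset[OF circ])
  then show "indep_family J (t \<circ> f)"
    by (rule indep_family_reindex) (use J inj in \<open>auto intro: inj_on_subset\<close>)
next
  fix P Q
  assume PQ: "P \<noteq> {} \<and> Q \<noteq> {} \<and> P \<inter> Q = {} \<and> P \<union> Q = V"
  then have "f ` P \<inter> f ` Q = {}"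
    using inj_on_image_Int[OF inj, of P Q] by auto
  then have "\<not> indep (t ` f ` P) (t ` f ` Q)"
    by (rule circuit_partition[OF circ, rotated 2]) (use PQ in auto)
  then show "\<not> indep ((t \<circ> f) ` P) ((t \<circ> f) ` Q)"
    by (simp add: image_comp)
qed

lemma circuit_exists:
  assumes circuits: "\<forall>n\<ge>1. \<exists>t. circuit {..n::nat} t" and V: "finite V" "2 \<le> card V"
  shows "\<exists>t. circuit V t"
proof -
  define n where "n = card V - 1"
  have n: "1 \<le> n" "card V = card {..n}"
    using V(2) by (simp_all add: n_def)
  then obtain f where f: "bij_betw f V {..n}"
    using finite_same_card_bij[OF V(1) finite_atMost] by blast
  obtain t where "circuit {..n} t"
    using circuits n(1) by blast
  then have "circuit V (t \<circ> f)"
    using f by (simp add: bij_betw_def circuit_reindex)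
  then show ?thesis by blast
qed

end

section \<open>Maps preserving independence\<close>

locale independence_pair =
  source: finite_independence S D + target: finite_independence U indep
  for S :: "'v set" and D :: "'v set \<Rightarrow> 'v set \<Rightarrow> bool"
    and U :: "'u set" and indep :: "'u set \<Rightarrow> 'u set \<Rightarrow> bool"
begin

lemma constant_extension_preserves_indep:
  assumes min: "source.minimal_dependent A B" and const: "indep {e} {e}"
    and t: "t ` (A \<union> B) \<subseteq> U" "\<forall>J\<subset>A \<union> B. target.indep_family J t"
    and XY: "D X Y"
  defines "s \<equiv> \<lambda>v. if v \<in> A \<union> B then t v else e"
  shows "indep (s ` X) (s ` Y)"
proof -
  define X' Y' where "X' = X \<inter> (A \<union> B)" and "Y' = Y \<inter> (A \<union> B)"
  have sub: "X' \<subseteq> A \<union> B" "Y' \<subseteq> A \<union> B"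
    by (auto simp: X'_def Y'_def)
  have "finite (A \<union> B)"
    using min by (simp add: source.minimal_dependent_def)
  then have fin: "finite (t ` X')" "finite (t ` Y')"
    using sub by (simp_all add: finite_subset)
  have tU: "t ` X' \<subseteq> U" "t ` Y' \<subseteq> U"
    using t(1) sub by auto
  have D: "D X' Y'"
    using XY by (rule source.indep_mono) (auto simp: X'_def Y'_def)
  have "indep (t ` X') (t ` Y')"
  proof (cases "X' = {} \<or> Y' = {}")
    case True
    then show ?thesis
      using fin tU by (auto simp: target.indep_empty_right target.indep_empty_left)
  next
    case False
    then have "X' \<union> Y' \<subset> A \<union> B"
      using source.minimal_dependent_indep_proper[OF min D] sub by blast
    moreover have "X' \<inter> Y' = {}"
      using source.minimal_dependent_indep_disjoint[OF min D sub(1)] .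
    ultimately show ?thesis
      using target.indep_familyD[of "X' \<union> Y'" t X' Y'] t(2) by simp
  qed
  with const have "indep (insert e (t ` X')) (insert e (t ` Y'))"
    by (rule target.indep_insert_constant)
  then show ?thesis
    by (rule target.indep_mono) (auto simp: s_def X'_def Y'_def)
qed

lemma minimal_dependent_realization:
  assumes min: "source.minimal_dependent A B"
    and circuits: "\<forall>n\<ge>1. \<exists>t. target.circuit {..n::nat} t"
  obtains t where "t ` (A \<union> B) \<subseteq> U" "\<forall>J\<subset>A \<union> B. target.indep_family J t"
    and "\<not> indep (t ` A) (t ` B)"
  using min
proof (cases rule: source.minimal_dependent_cases)
  case (diagonal x)
  obtain c where c: "target.circuit {..1::nat} c"
    using circuits by blast
  then have "\<not> indep {c 0} {c 0}"
    by (rule target.circuit_not_constant) (auto simp: atMost_Suc)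
  moreover have "c 0 \<in> U"
    using c by (auto simp: target.circuit_def)
  moreover have "target.indep_family J (\<lambda>_. c 0)" if "J \<subset> {x}" for J :: "'v set"
  proof -
    have "J = {}"
      using that by blast
    then show ?thesis
      by (simp add: target.indep_family_empty)
  qed
  ultimately show ?thesis
    using that[of "\<lambda>_. c 0"] diagonal by simp
next
  case disjoint
  have nonempty: "A \<noteq> {}" "B \<noteq> {}"
    using source.minimal_dependent_nonempty[OF min] .
  have fin: "finite A" "finite B"
    using min by (auto simp: source.minimal_dependent_def)
  then have "0 < card A" "0 < card B"
    using nonempty by (simp_all add: card_gt_0_iff)
  then have "2 \<le> card (A \<union> B)"
    using fin disjoint by (simp add: card_Un_disjoint)
  then obtain t where circ: "target.circuit (A \<union> B) t"
    using target.circuit_exists[OF circuits, of "A \<union> B"] fin by auto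
  show ?thesis
  proof (rule that)
    show "t ` (A \<union> B) \<subseteq> U" "\<forall>J\<subset>A \<union> B. target.indep_family J t"
      using circ by (simp_all add: target.circuit_def)
    show "\<not> indep (t ` A) (t ` B)"
      by (rule target.circuit_partition[OF circ nonempty disjoint refl])
  qed
qed

lemma separating_map:
  assumes AB: "finite A" "finite B" "A \<subseteq> S" "B \<subseteq> S" "\<not> D A B"
    and const: "indep {e} {e}"
    and circuits: "\<forall>n\<ge>1. \<exists>t. target.circuit {..n::nat} t"
  obtains s where "\<forall>X Y. D X Y \<longrightarrow> indep (s ` X) (s ` Y)" "\<not> indep (s ` A) (s ` B)"
proof -
  obtain A' B' where sub: "A' \<subseteq> A" "B' \<subseteq> B" and min: "source.minimal_dependent A' B'"
    using source.minimal_dependent_exists[OF AB] .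
  obtain t where t: "t ` (A' \<union> B') \<subseteq> U" "\<forall>J\<subset>A' \<union> B'. target.indep_family J t"
    and dep: "\<not> indep (t ` A') (t ` B')"
    by (rule minimal_dependent_realization[OF min circuits])
  let ?s = "\<lambda>v. if v \<in> A' \<union> B' then t v else e"
  show ?thesis
  proof (rule that)
    show "\<forall>X Y. D X Y \<longrightarrow> indep (?s ` X) (?s ` Y)"
      using constant_extension_preserves_indep[OF min const t] by simp
    have "\<not> indep (?s ` A') (?s ` B')"
      using dep by (simp cong: image_cong_simp)
    then show "\<not> indep (?s ` A) (?s ` B)"
      by (rule contrapos_nn)
        (rule target.indep_mono[OF _ image_mono[OF sub(1)] image_mono[OF sub(2)]])
  qed
qed

end

section \<open>Derivability\<close>

lemma deduces_Cons_member:
  assumes "\<Sigma> \<turnstile> xs \<perp> ys" "x \<in> set xs"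
  shows "\<Sigma> \<turnstile> (x # xs) \<perp> ys"
proof -
  obtain us vs where xs: "xs = us @ [x] @ vs"
    using assms(2) by (auto simp: in_set_conv_decomp)
  have "\<Sigma> \<turnstile> (us @ [x, x] @ vs) \<perp> ys"
    using assms(1) unfolding xs by (rule g3)
  then show ?thesis
    by (rule f3) (simp_all add: xs)
qed

lemma deduces_subset_left:
  assumes "\<Sigma> \<turnstile> xs \<perp> ys" "set zs \<subseteq> set xs"
  shows "\<Sigma> \<turnstile> zs \<perp> ys"
proof -
  have "\<Sigma> \<turnstile> (zs @ xs) \<perp> ys"
    using assms(2) by (induction zs) (use assms(1) in \<open>auto intro: deduces_Cons_member\<close>)
  then show ?thesis
    by (blast intro: b3 c3)
qed

lemma deduces_subset:
  assumes "\<Sigma> \<turnstile> xs \<perp> ys" "set xs' \<subseteq> set xs" "set ys' \<subseteq> set ys"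
  shows "\<Sigma> \<turnstile> xs' \<perp> ys'"
  using assms by (meson b3 deduces_subset_left)

definition deduces_sets :: "'v ind_atom set \<Rightarrow> 'v set \<Rightarrow> 'v set \<Rightarrow> bool" where
  "deduces_sets \<Sigma> A B \<longleftrightarrow> (\<exists>xs ys. set xs = A \<and> set ys = B \<and> \<Sigma> \<turnstile> xs \<perp> ys)"

lemma deduces_sets_set_iff: "deduces_sets \<Sigma> (set xs) (set ys) \<longleftrightarrow> \<Sigma> \<turnstile> xs \<perp> ys"
  unfolding deduces_sets_def using deduces_subset by blast

lemma finite_independence_deduces_sets: "finite_independence UNIV (deduces_sets \<Sigma>)"
proof
  fix A B B' C :: "'a set" and x
  show "finite A" if "deduces_sets \<Sigma> A B"
    using that by (auto simp: deduces_sets_def)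
  show "deduces_sets \<Sigma> B A" if "deduces_sets \<Sigma> A B" for A B
    using that b3 unfolding deduces_sets_def by blast
  show "deduces_sets \<Sigma> A {}" if "finite A"
    using that a3 unfolding deduces_sets_def by (metis finite_list empty_set)
  show "deduces_sets \<Sigma> A B'" if AB: "deduces_sets \<Sigma> A B" and "B' \<subseteq> B"
  proof -
    obtain xs ys where "A = set xs" "B = set ys" "\<Sigma> \<turnstile> xs \<perp> ys"
      using AB by (auto simp: deduces_sets_def)
    moreover from this obtain ys' where "B' = set ys'"
      using \<open>B' \<subseteq> B\<close> by (metis List.finite_set finite_list finite_subset)
    ultimately show ?thesis
      using \<open>B' \<subseteq> B\<close> by (auto simp: deduces_sets_set_iff intro: deduces_subset)
  qed
  show "deduces_sets \<Sigma> A (B \<union> C)"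
    if AB: "deduces_sets \<Sigma> A B" and ABC: "deduces_sets \<Sigma> (A \<union> B) C"
  proof -
    obtain xs ys zs where sets: "A = set xs" "B = set ys" "C = set zs"
      using AB ABC by (auto simp: deduces_sets_def)
    then have "\<Sigma> \<turnstile> xs \<perp> ys" "\<Sigma> \<turnstile> (xs @ ys) \<perp> zs"
      using AB ABC by (simp_all flip: deduces_sets_set_iff)
    then have "\<Sigma> \<turnstile> xs \<perp> (ys @ zs)"
      by (rule d3)
    then show ?thesis
      by (simp add: sets flip: deduces_sets_set_iff)
  qed
  show "deduces_sets \<Sigma> {x} B" if const: "deduces_sets \<Sigma> {x} {x}" and "finite B"
  proof -
    obtain ys where "B = set ys"
      using \<open>finite B\<close> finite_list by blast
    then show ?thesis
      using const e3[of \<Sigma> x ys] by (simp flip: deduces_sets_set_iff)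
  qed
qed simp

section \<open>Independence over the empty set\<close>

lemma bdd_sub_subset: "\<lbrakk>bdd_sub M \<kappa> B; A \<subseteq> B\<rbrakk> \<Longrightarrow> bdd_sub M \<kappa> A"
  unfolding bdd_sub_def using card_of_mono1 ordLeq_ordLess_trans by blast

lemma (in pre_independence) ind_exchange:
  assumes bdd: "bdd_sub M \<kappa> (A \<union> B \<union> C \<union> D)"
    and AB: "ind A D B" and ABC: "ind (A \<union> B) D C"
  shows "ind A D (B \<union> C)"
proof -
  have bdd': "bdd_sub M \<kappa> X" if "X \<subseteq> A \<union> B \<union> C \<union> D" for X
    using bdd that by (rule bdd_sub_subset)
  have "ind (A \<union> B \<union> D) D C"
    using ABC by (rule normality[rotated -1]) (auto intro: bdd')
  then have "ind C D (A \<union> B \<union> D)"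
    by (rule symmetry[rotated -1]) (auto intro: bdd')
  then have "ind C (B \<union> D) (A \<union> B \<union> D)"
    by (rule base_monotonicity[rotated -1]) (auto intro: bdd')
  then have "ind C (B \<union> D) A"
    by (rule monotonicity[rotated -1]) (auto intro: bdd')
  then have "ind (C \<union> (B \<union> D)) (B \<union> D) A"
    by (rule normality[rotated -1]) (auto intro: bdd')
  moreover have "ind B D A"
    using AB by (rule symmetry[rotated -1]) (auto intro: bdd')
  then have "ind (B \<union> D) D A"
    by (rule normality[rotated -1]) (auto intro: bdd')
  ultimately have "ind (C \<union> (B \<union> D)) D A"
    by (rule transitivity[rotated -2]) (auto intro: bdd')
  then have "ind A D (C \<union> (B \<union> D))"
    by (rule symmetry[rotated -1]) (auto intro: bdd')
  then show ?thesis
    by (rule monotonicity[rotated -1]) (auto intro: bdd')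
qed

locale pre_independence_Cinfinite = pre_independence L M \<kappa> ind
  for L :: "('f, 'r) signature" and M :: "('f, 'r, 'u) fostruct" and \<kappa> :: "'u rel"
    and ind :: "'u set \<Rightarrow> 'u set \<Rightarrow> 'u set \<Rightarrow> bool" +
  assumes Cinfinite_bound: "Cinfinite \<kappa>"
begin

lemma finite_bdd: "\<lbrakk>finite X; X \<subseteq> univ M\<rbrakk> \<Longrightarrow> bdd_sub M \<kappa> X"
  using Cfinite_ordLess_Cinfinite[OF _ Cinfinite_bound, of "|X|"]
  by (simp add: bdd_sub_def cfinite_def Field_card_of card_of_card_order_on)

definition ind_over_empty :: "'u set \<Rightarrow> 'u set \<Rightarrow> bool" where
  "ind_over_empty A B \<longleftrightarrow> finite (A \<union> B) \<and> A \<union> B \<subseteq> univ M \<and> ind A {} B"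

sublocale finite_independence "univ M" ind_over_empty
proof
  fix A B B' C :: "'u set" and x
  show "finite A" "A \<subseteq> univ M" if "ind_over_empty A B"
    using that by (simp_all add: ind_over_empty_def)
  show "ind_over_empty B A" if "ind_over_empty A B" for A B
    using that symmetry[of A B "{}"] by (simp add: ind_over_empty_def finite_bdd)
  show "ind_over_empty A {}" if "finite A" "A \<subseteq> univ M"
    using that existence[of "{}" A] symmetry[of "{}" A "{}"]
    by (simp add: ind_over_empty_def finite_bdd)
  show "ind_over_empty A B'" if "ind_over_empty A B" "B' \<subseteq> B"
    using that monotonicity[of A B "{}" A B'] finite_subset
    by (auto simp: ind_over_empty_def finite_bdd)
  show "ind_over_empty A (B \<union> C)" if "ind_over_empty A B" "ind_over_empty (A \<union> B) C"
    using that ind_exchange[of A B C "{}"] by (simp add: ind_over_empty_def finite_bdd)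
  show "ind_over_empty {x} B" if "ind_over_empty {x} {x}" "finite B" "B \<subseteq> univ M"
    using that anti_reflexivity[of "{x}" "{}" B] by (simp add: ind_over_empty_def finite_bdd)
qed

lemma indep_seq_indep_family:
  assumes "indep_seq M ind as"
  shows "indep_family {..<length as} ((!) as)"
proof (rule indep_family_sequence)
  fix j
  assume j: "j < length as"
  have "(!) as ` {..<j} = set (take j as)"
    using j nth_image[of j as] by (simp add: lessThan_atLeast0)
  moreover have "ind_over_empty (set (take j as)) {as ! j}"
    using assms j by (auto simp: ind_over_empty_def indep_seq_def dest: in_set_takeD)
  ultimately show "ind_over_empty ((!) as ` {..<j}) {as ! j}"
    by simp
qed

lemma federated_seq_circuit:
  assumes "federated_seq M ind as"
  shows "\<exists>t. circuit {..length as} t"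
proof -
  let ?I = "{..<length as}"
  obtain d where seq: "indep_seq M ind as" and d: "d \<in> univ M" "\<not> ind {d} {} (set as)"
    and crit: "\<And>j. j < length as \<Longrightarrow> ind {d} {} (set as - {as ! j})"
    using assms unfolding federated_seq_def by blast
  have as: "set as \<subseteq> univ M" "distinct as"
    using seq by (simp_all add: indep_seq_def)
  define t where "t = (!) (as @ [d])"
  have td: "t (length as) = d"
    by (simp add: t_def)
  have tJ: "t ` J = (!) as ` J" if "J \<subseteq> ?I" for J
    using that by (auto simp: t_def nth_append intro!: image_cong)
  have tI: "t ` ?I = set as"
    using tJ[of ?I] nth_image[of "length as" as] by (simp add: lessThan_atLeast0)
  have "circuit (insert (length as) ?I) t"
  proof (rule circuit_insert)
    show "indep_family ?I t"
      using indep_seq_indep_family[OF seq] tJ unfolding indep_family_def by simp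
    show "\<not> ind_over_empty {t (length as)} (t ` ?I)"
      using d tI td by (simp add: ind_over_empty_def)
    fix i
    assume i: "i \<in> ?I"
    have "inj_on t ?I"
      using tI as(2) by (simp add: eq_card_imp_inj_on distinct_card)
    then have "t ` (?I - {i}) = set as - {as ! i}"
      using i tI tJ[of "{i}"] by (simp add: inj_on_image_set_diff)
    then show "ind_over_empty {t (length as)} (t ` (?I - {i}))"
      using crit[of i] i d(1) as(1) td by (auto simp: ind_over_empty_def)
  qed (use d as tI td in auto)
  then show ?thesis
    by (metis lessThan_Suc lessThan_Suc_atMost)
qed

lemma entails_imp_deduces:
  assumes alg: "algebraic_point M ind e" and fed: "federated M ind"
    and ent: "entails M ind \<Sigma> (xs \<perp> ys)"
  shows "\<Sigma> \<turnstile> xs \<perp> ys"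
proof (rule ccontr)
  assume "\<not> \<Sigma> \<turnstile> xs \<perp> ys"
  then have underivable: "\<not> deduces_sets \<Sigma> (set xs) (set ys)"
    by (simp add: deduces_sets_set_iff)
  interpret independence_pair UNIV "deduces_sets \<Sigma>" "univ M" ind_over_empty
    by (intro independence_pair.intro finite_independence_deduces_sets finite_independence_axioms)
  have "ind_over_empty {e} {e}"
    using alg by (simp add: ind_over_empty_def algebraic_point_def)
  moreover have "\<forall>n\<ge>1. \<exists>t. circuit {..n::nat} t"
    using fed federated_seq_circuit unfolding federated_def by metis
  ultimately obtain s
    where pres: "\<forall>X Y. deduces_sets \<Sigma> X Y \<longrightarrow> ind_over_empty (s ` X) (s ` Y)"
      and dep: "\<not> ind_over_empty (s ` set xs) (s ` set ys)"
    by (rule separating_map[OF List.finite_set List.finite_set subset_UNIV subset_UNIV underivable])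
  have range: "range s \<subseteq> univ M"
  proof (intro image_subsetI)
    fix v
    have "ind_over_empty (s ` {v}) (s ` {})"
      by (rule pres[rule_format]) (simp add: source.indep_empty_right)
    then show "s v \<in> univ M"
      by (simp add: ind_over_empty_def)
  qed
  have "sat_atom ind s \<psi>" if "\<psi> \<in> \<Sigma>" for \<psi>
  proof (cases \<psi>)
    case (Indep us ws)
    then show ?thesis
      using that pres[rule_format, of "set us" "set ws"] hyp[of \<psi> \<Sigma>]
      by (simp add: deduces_sets_set_iff ind_over_empty_def)
  qed
  then have "ind (s ` set xs) {} (s ` set ys)"
    using ent range by (auto simp: entails_def)
  then show False
    using dep range by (auto simp: ind_over_empty_def)
qed

end

lemma (in aec) monster_model_Cinfinite: "monster_model L K le LS \<kappa> M \<Longrightarrow> Cinfinite \<kappa>"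
  unfolding monster_model_def using LS_card(2) cinfinite_mono ordLess_imp_ordLeq by blast

theorem theorem4p5:
  fixes L :: "('f, 'r) signature"
    and K :: "('f, 'r, 'u) fostruct set"
    and le :: "('f, 'r, 'u) fostruct \<Rightarrow> ('f, 'r, 'u) fostruct \<Rightarrow> bool"
    and LS \<kappa> :: "'u rel"
    and M :: "('f, 'r, 'u) fostruct"
    and ind :: "'u set \<Rightarrow> 'u set \<Rightarrow> 'u set \<Rightarrow> bool"
  assumes "aec L K le LS"
    and "amalgamation L K le"
    and "joint_embedding L K le"
    and "arbitrarily_large_models K"
    and "monster_model L K le LS \<kappa> M"
    and "pre_independence L M \<kappa> ind"
    and "federated M ind"
    and "\<exists>e. algebraic_point M ind e"
  shows "\<forall>(\<Sigma> :: 'v ind_atom set) xs ys. entails M ind \<Sigma> (xs \<perp> ys) \<longrightarrow> \<Sigma> \<turnstile> xs \<perp> ys"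
proof -
  interpret pre_independence_Cinfinite L M \<kappa> ind
    using assms(6) aec.monster_model_Cinfinite[OF assms(1,5)]
    by (simp add: pre_independence_Cinfinite_def pre_independence_Cinfinite_axioms_def)
  show ?thesis
    using assms(7,8) entails_imp_deduces by blast
qed

end
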